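(* For any labeling scheme for matchings (in the adversarial model described in the context) that uses $m$ possible labels, there is an adversary whose probability of successful forgery is at least $\Omega(1/\sqrt{m})$.
   Context: A matching here is a graph that is a disjoint union of edges. A labeling scheme (adjacency sketch) for a family of graphs consists of a randomized encoder that, given a graph $G$ in the family, outputs a labeling $\ell:V(G)\to L$ into a set $L$ of possible labels, and a deterministic decoder $\mathcal D:L\times L\to\{0,1\}$; the scheme errs only on non-edges, i.e. $\mathcal D(\ell(u),\ell(v))=1$ always holds for edges $(u,v)$. Adversarial game: the adversary chooses $G$ in the family with $n$ vertices; labels are drawn by the encoder; the (computationally unbounded) adversary adaptively requests the labels of vertices $x_1,\dots,x_k$, $k\le n-2$, each choice possibly depending on earlier answers; it then names two distinct vertices $x_{k+1},x_{k+2}$ not previously queried. It wins (forges) if $(x_{k+1},x_{k+2})\notin E(G)$ but $\mathcal D(\ell(x_{k+1}),\ell(x_{k+2}))=1$. *)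

theory Defs
  imports
    "HOL-Probability.Probability_Mass_Function"
    "HOL-Library.Disjoint_Sets"
    "Graph_Theory.Pair_Digraph"
begin

text \<open>
  A finite simple graph is a \<open>pair_graph\<close>: finite, loopfree, with a symmetric arc relation, so that
  \<open>(u, v) \<in> parcs G\<close> says that \<open>uv\<close> is an edge.
\<close>

definition edge_sets :: "'v pair_pre_digraph \<Rightarrow> 'v set set" where
  "edge_sets G = {{u, v} | u v. (u, v) \<in> parcs G}"

text \<open>
  Disjoint unions of edges: the edges are pairwise disjoint and cover all vertices, so there are
  no isolated vertices.
\<close>

definition matchings :: "'v pair_pre_digraph set" where
  "matchings = {G. pair_graph G \<and> partition_on (pverts G) (edge_sets G)}"

text \<open>
  The values of a labeling outside \<open>pverts G\<close> are never looked at. Since \<open>G\<close> is finite, a discrete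
  distribution over labelings is fully general when \<open>L\<close> is finite.
\<close>

definition labeling_scheme ::
  "'v pair_pre_digraph set \<Rightarrow> 'l set \<Rightarrow> ('v pair_pre_digraph \<Rightarrow> ('v \<Rightarrow> 'l) pmf) \<Rightarrow>
    ('l \<Rightarrow> 'l \<Rightarrow> bool) \<Rightarrow> bool" where
  "labeling_scheme F L enc dec \<longleftrightarrow>
     (\<forall>G\<in>F. \<forall>lab\<in>set_pmf (enc G).
        (\<forall>v\<in>pverts G. lab v \<in> L) \<and> (\<forall>(u, v)\<in>parcs G. dec (lab u) (lab v)))"

text \<open>
  An adaptive deterministic strategy is a decision tree: \<open>Query x f\<close> requests the label of \<open>x\<close> and
  continues with \<open>f a\<close> upon the answer \<open>a\<close>; \<open>Output u v\<close> stops and names the pair \<open>(u, v)\<close>.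
  The number of queries may depend on the answers.
\<close>

datatype ('v, 'l) strategy =
    Output 'v 'v
  | Query 'v "'l \<Rightarrow> ('v, 'l) strategy"

text \<open>
  \<open>legal V L xs A\<close>: after the queries \<open>xs\<close> have been made, the remaining strategy \<open>A\<close> obeys the rules
  of the game whatever answers in \<open>L\<close> it receives.
\<close>

primrec legal :: "'v set \<Rightarrow> 'l set \<Rightarrow> 'v list \<Rightarrow> ('v, 'l) strategy \<Rightarrow> bool" where
  "legal V L xs (Output u v) \<longleftrightarrow>
     length xs + 2 \<le> card V \<and> u \<in> V \<and> v \<in> V \<and> u \<noteq> v \<and> u \<notin> set xs \<and> v \<notin> set xs"
| "legal V L xs (Query x f) \<longleftrightarrow> x \<in> V \<and> (\<forall>a\<in>L. legal V L (xs @ [x]) (f a))"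

primrec forges ::
  "'v pair_pre_digraph \<Rightarrow> ('l \<Rightarrow> 'l \<Rightarrow> bool) \<Rightarrow> ('v \<Rightarrow> 'l) \<Rightarrow> ('v, 'l) strategy \<Rightarrow> bool" where
  "forges G dec lab (Output u v) \<longleftrightarrow> (u, v) \<notin> parcs G \<and> dec (lab u) (lab v)"
| "forges G dec lab (Query x f) \<longleftrightarrow> forges G dec lab (f (lab x))"

definition forgery_prob ::
  "('v pair_pre_digraph \<Rightarrow> ('v \<Rightarrow> 'l) pmf) \<Rightarrow> ('l \<Rightarrow> 'l \<Rightarrow> bool) \<Rightarrow> 'v pair_pre_digraph \<Rightarrow>
    ('v, 'l) strategy \<Rightarrow> real" where
  "forgery_prob enc dec G A = measure_pmf.prob (enc G) {lab. forges G dec lab A}"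

end

theory Submission
  imports Defs
begin

text \<open>
  Take \<open>N\<close> disjoint edges \<open>u\<^sub>i v\<^sub>i\<close> with labels \<open>A i\<close> and \<open>B i\<close>. For a fixed labeling let \<open>s\<close> be
  the probability that \<open>A i\<close> and \<open>B j\<close> are compatible for independent uniform \<open>i\<close>, \<open>j\<close>, and let
  \<open>T\<close> be the probability that \<open>B i = B e\<close> for a uniform \<open>e\<close> and a uniform \<open>i\<close> with
  \<open>A i = A e\<close>. Every pair of labels that occurs on an edge is compatible, so either many pairs are
  compatible, or \<open>A e\<close> nearly determines \<open>B e\<close>: the inequality of arithmetic and geometric means
  gives \<open>s + T \<ge> 2 / sqrt m\<close>.

  Outputting a random pair \<open>(u\<^sub>i, v\<^sub>j)\<close> forges with probability about \<open>s\<close>. To forge with probability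
  about \<open>T\<close>, learn both labels of a random edge \<open>e\<close>, find an edge \<open>j\<close> with \<open>B j = B e\<close> by looking
  only at ends \<open>v\<^sub>j\<close> and a random edge \<open>i\<close> with \<open>A i = A e\<close> by looking only at ends \<open>u\<^sub>i\<close>, and
  output \<open>(u\<^sub>j, v\<^sub>i)\<close>: if \<open>B i = B e = B j\<close>, this pair looks like the edge \<open>j\<close>. The edges \<open>j\<close> are
  taken from the block of \<open>e\<close> in a fixed partition of the edges into \<open>Q\<close> blocks of size \<open>Q\<close>, and
  the edges \<open>i\<close> from outside of it, which costs only \<open>2 m / Q\<close>. Averaging over the labeling makes
  one of the two random strategies, hence one of its deterministic instances, succeed often.
\<close>

section \<open>Compatible pairs against label collisions\<close>

text \<open>The \<open>k\<close> elements of a fiber have weight \<open>1 / k\<close> each, so every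
  value in the image contributes exactly 1.\<close>

lemma sum_inverse_card_fiber:
  fixes f :: "'a \<Rightarrow> 'b"
  assumes "finite X"
  shows "(\<Sum>e\<in>X. 1 / real (card {i\<in>X. f i = f e})) = real (card (f ` X))"
proof -
  have "(\<Sum>e\<in>X. 1 / real (card {i\<in>X. f i = f e}))
      = (\<Sum>y\<in>f ` X. \<Sum>e\<in>{x\<in>X. f x = y}. 1 / real (card {i\<in>X. f i = f e}))"
    using assms by (rule sum.image_gen)
  also have "\<dots> = (\<Sum>y\<in>f ` X. 1)"
  proof (rule sum.cong[OF refl])
    fix y assume y: "y \<in> f ` X"
    have "(\<Sum>e\<in>{x\<in>X. f x = y}. 1 / real (card {i\<in>X. f i = f e}))
        = (\<Sum>e\<in>{x\<in>X. f x = y}. 1 / real (card {i\<in>X. f i = y}))"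
      by (rule sum.cong) auto
    also have "\<dots> = 1"
      using y assms by (auto simp: card_eq_0_iff)
    finally show "(\<Sum>e\<in>{x\<in>X. f x = y}. 1 / real (card {i\<in>X. f i = f e})) = 1" .
  qed
  finally show ?thesis by simp
qed

lemma sum_inverse_card_fiber_le:
  assumes "finite X" "finite L" "f ` X \<subseteq> L"
  shows "(\<Sum>e\<in>X. 1 / real (card {i\<in>X. f i = f e})) \<le> real (card L)"
  using assms by (simp add: sum_inverse_card_fiber card_mono)

text \<open>Double counting: the summand of \<open>e\<close> counts the pairs \<open>(i, j)\<close>
  with \<open>A i = A e\<close> and \<open>B j = B e\<close>, each with weight
  \<open>1 / w e\<close>. After swapping the sums, a pair \<open>(i, j)\<close> collects weight from
  the edges labeled \<open>(A i, B j)\<close>. If there are any, their weights add up to 1, and the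
  pair is compatible because it occurs on an edge.\<close>

lemma sum_le_card_compatible:
  fixes A :: "'i \<Rightarrow> 'a" and B :: "'i \<Rightarrow> 'b"
  assumes X: "finite X" and dec: "\<And>i. i \<in> X \<Longrightarrow> dec (A i) (B i)"
  shows "(\<Sum>e\<in>X. real (card {i\<in>X. A i = A e}) * real (card {j\<in>X. B j = B e})
            / real (card {i\<in>X. A i = A e \<and> B i = B e}))
         \<le> real (card {(i, j)\<in>X \<times> X. dec (A i) (B j)})"
proof -
  define w where "w e = real (card {i\<in>X. A i = A e \<and> B i = B e})" for e
  have "(\<Sum>e\<in>X. real (card {i\<in>X. A i = A e}) * real (card {j\<in>X. B j = B e}) / w e)
      = (\<Sum>e\<in>X. \<Sum>p\<in>X \<times> X. of_bool (A (fst p) = A e \<and> B (snd p) = B e) / w e)"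
  proof (rule sum.cong[OF refl])
    fix e
    have "{p\<in>X \<times> X. A (fst p) = A e \<and> B (snd p) = B e} = {i\<in>X. A i = A e} \<times> {j\<in>X. B j = B e}"
      by auto
    then show "real (card {i\<in>X. A i = A e}) * real (card {j\<in>X. B j = B e}) / w e
        = (\<Sum>p\<in>X \<times> X. of_bool (A (fst p) = A e \<and> B (snd p) = B e) / w e)"
      using X by (simp flip: sum_divide_distrib add: sum_of_bool_eq Int_def card_cartesian_product)
  qed
  also have "\<dots> = (\<Sum>p\<in>X \<times> X. \<Sum>e\<in>X. of_bool (A (fst p) = A e \<and> B (snd p) = B e) / w e)"
    by (rule sum.swap)
  also have "\<dots> \<le> (\<Sum>p\<in>X \<times> X. of_bool (dec (A (fst p)) (B (snd p))))"
  proof (rule sum_mono)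
    fix p assume "p \<in> X \<times> X"
    define E where "E = {e\<in>X. A e = A (fst p) \<and> B e = B (snd p)}"
    have fE: "finite E" using X by (simp add: E_def)
    have "(\<Sum>e\<in>X. of_bool (A (fst p) = A e \<and> B (snd p) = B e) / w e) = (\<Sum>e\<in>E. 1 / w e)"
      using X by (intro sum.mono_neutral_cong_right) (auto simp: E_def)
    also have "\<dots> = (\<Sum>e\<in>E. 1 / real (card E))"
      by (rule sum.cong) (auto simp: E_def w_def)
    also have "\<dots> \<le> of_bool (E \<noteq> {})"
      using fE by (auto simp: card_eq_0_iff)
    also have "\<dots> \<le> of_bool (dec (A (fst p)) (B (snd p)))"
      using dec by (force simp: E_def)
    finally show "(\<Sum>e\<in>X. of_bool (A (fst p) = A e \<and> B (snd p) = B e) / w e)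
        \<le> of_bool (dec (A (fst p)) (B (snd p)))" .
  qed
  also have "\<dots> = real (card {(i, j)\<in>X \<times> X. dec (A i) (B j)})"
    using X by (auto simp: sum_of_bool_eq Int_def intro!: arg_cong[where f = card])
  finally show ?thesis by (simp add: w_def)
qed

text \<open>Arithmetic against geometric mean for three numbers: the logarithms add up to 0, and
  \<open>ln x \<le> x - 1\<close>.\<close>

lemma three_le_sum_if_prod_eq_1:
  fixes x y z :: real
  assumes "x > 0" "y > 0" "z > 0" "x * y * z = 1"
  shows "3 \<le> x + y + z"
proof -
  have "ln x + ln y + ln z = ln (x * y * z)"
    using assms(1-3) by (simp add: ln_mult)
  then show ?thesis
    using assms ln_le_minus_one[of x] ln_le_minus_one[of y] ln_le_minus_one[of z] by simp
qed

text \<open>The two summands on the right are \<open>s\<close> and \<open>T\<close>.\<close>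

lemma compatible_collision_tradeoff:
  fixes A :: "'i \<Rightarrow> 'a" and B :: "'i \<Rightarrow> 'b"
  assumes X: "finite X" "X \<noteq> {}" and L: "finite L" "B ` X \<subseteq> L"
    and dec: "\<And>i. i \<in> X \<Longrightarrow> dec (A i) (B i)"
  shows "2 / sqrt (real (card L)) \<le>
      real (card {(i, j)\<in>X \<times> X. dec (A i) (B j)}) / (real (card X))\<^sup>2
      + (\<Sum>e\<in>X. real (card {i\<in>X. A i = A e \<and> B i = B e}) / real (card {i\<in>X. A i = A e}))
          / real (card X)"
proof -
  define n where "n e = real (card {i\<in>X. A i = A e})" for e
  define r where "r e = real (card {i\<in>X. B i = B e})" for e
  define w where "w e = real (card {i\<in>X. A i = A e \<and> B i = B e})" for e
  define N where "N = real (card X)"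
  define m where "m = real (card L)"
  define S where "S = real (card {(i, j)\<in>X \<times> X. dec (A i) (B j)})"
  define T where "T = (\<Sum>e\<in>X. w e / n e)"
  have pos: "n e > 0" "r e > 0" "w e > 0" if "e \<in> X" for e
    using that X by (auto simp: n_def r_def w_def card_gt_0_iff)
  have N: "N > 0" using X by (auto simp: N_def card_gt_0_iff)
  have m: "m > 0" using X L by (auto simp: m_def card_gt_0_iff)
  have S: "(\<Sum>e\<in>X. n e * r e / w e) \<le> S"
    unfolding n_def r_def w_def S_def
    by (rule sum_le_card_compatible[where dec = dec, OF X(1)]) (rule dec)
  have R: "(\<Sum>e\<in>X. 1 / r e) \<le> m"
    unfolding r_def m_def by (rule sum_inverse_card_fiber_le[OF X(1) L])
  have "3 * N = (\<Sum>e\<in>X. 3)" by (simp add: N_def)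
  \<comment> \<open>The ratios multiply to 1, and so do the coefficients. The coefficients are
    chosen such that the terms with \<open>1 / r e\<close> add up to at most \<open>N\<close>, which
    leaves \<open>2 * N\<close> for the other two.\<close>
  also have "\<dots> \<le> (\<Sum>e\<in>X. sqrt m / N * (n e * r e / w e) + sqrt m * (w e / n e) + N / m * (1 / r e))"
  proof (intro sum_mono three_le_sum_if_prod_eq_1)
    fix e assume e: "e \<in> X"
    note p = pos[OF e]
    show "0 < sqrt m / N * (n e * r e / w e)" "0 < sqrt m * (w e / n e)" "0 < N / m * (1 / r e)"
      using p N m by auto
    have "n e \<noteq> 0" "r e \<noteq> 0" "w e \<noteq> 0" "N \<noteq> 0" "m \<noteq> 0" using p N m by auto
    then have "sqrt m / N * (n e * r e / w e) * (sqrt m * (w e / n e)) * (N / m * (1 / r e))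
        = (sqrt m * sqrt m) / m"
      by (simp add: field_simps)
    also have "\<dots> = 1" using m by simp
    finally show "sqrt m / N * (n e * r e / w e) * (sqrt m * (w e / n e)) * (N / m * (1 / r e)) = 1" .
  qed
  also have "\<dots> = sqrt m / N * (\<Sum>e\<in>X. n e * r e / w e) + sqrt m * T + N / m * (\<Sum>e\<in>X. 1 / r e)"
    unfolding T_def by (simp only: sum.distrib sum_distrib_left)
  also have "\<dots> \<le> sqrt m / N * S + sqrt m * T + N / m * m"
    using S R N m by (intro add_mono mult_left_mono) auto
  finally have "2 * N \<le> sqrt m * (S / N + T)"
    using m by (simp add: algebra_simps)
  then have "2 / sqrt m \<le> (S / N + T) / N"
    using m N by (simp add: field_simps)
  also have "\<dots> = S / N\<^sup>2 + T / N"
    by (simp add: add_divide_distrib power2_eq_square)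
  finally show ?thesis by (simp add: m_def S_def N_def T_def w_def n_def)
qed

section \<open>Uniform choice by residues\<close>

lemma sum_mod_multiple:
  fixes f :: "nat \<Rightarrow> 'a::semiring_1"
  shows "(\<Sum>t<q * n. f (t mod n)) = of_nat q * (\<Sum>k<n. f k)"
proof (induction q)
  case (Suc q)
  have "(\<Sum>t<Suc q * n. f (t mod n)) = (\<Sum>t<q * n. f (t mod n)) + (\<Sum>t=q * n..<q * n + n. f (t mod n))"
    using sum.atLeastLessThan_concat[of 0 "q * n" "q * n + n" "\<lambda>t. f (t mod n)"]
    by (simp only: atLeast0LessThan mult_Suc add.commute[of n])
  also have "(\<Sum>t=q * n..<q * n + n. f (t mod n)) = (\<Sum>k<n. f k)"
    using sum.shift_bounds_nat_ivl[of "\<lambda>t. f (t mod n)" 0 "q * n" n]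
    by (simp add: atLeast0LessThan add.commute)
  finally show ?case using Suc by (simp add: algebra_simps)
qed simp

text \<open>
  Strategies are deterministic, so the random element of a candidate set \<open>C\<close> that is only known
  after the queries is encoded by a number \<open>t < F\<close> chosen in advance: if \<open>card C\<close> divides \<open>F\<close>, then
  \<open>t mod card C\<close> is exactly uniform. \<open>F = fact N\<close> works for all nonempty \<open>C\<close> of size at most \<open>N\<close>.
\<close>

lemma card_nth_mod:
  fixes C :: "nat set"
  assumes C: "finite C" "C \<noteq> {}" and dvd: "card C dvd F"
  shows "real (card {t\<in>{..<F}. P (sorted_list_of_set C ! (t mod card C))})
       = real F * (real (card {c\<in>C. P c}) / real (card C))"
proof -
  let ?xs = "sorted_list_of_set C"
  obtain q where q: "F = q * card C" using dvd by (metis dvd_def mult.commute)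
  have "real (card {t\<in>{..<F}. P (?xs ! (t mod card C))})
      = (\<Sum>t<q * card C. of_bool (P (?xs ! (t mod card C))))"
    by (simp add: sum_of_bool_eq Int_def q)
  also have "\<dots> = real q * (\<Sum>k<card C. of_bool (P (?xs ! k)))"
    by (rule sum_mod_multiple)
  also have "(\<Sum>k<card C. of_bool (P (?xs ! k))) = (\<Sum>c\<in>C. of_bool (P c) :: real)"
    by (rule sum.reindex_bij_betw[where g = "\<lambda>c. of_bool (P c)"])
      (use C bij_betw_nth[of ?xs "{..<card C}" C] in simp)
  also have "\<dots> = real (card {c\<in>C. P c})"
    using C by (simp add: sum_of_bool_eq Int_def)
  finally show ?thesis using C by (simp add: q)
qed

section \<open>Averaging over the random labeling\<close>

lemma
  assumes "finite I"
  shows integrable_card_Collect: "integrable (measure_pmf p) (\<lambda>x. real (card {i\<in>I. P i x}))"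
    and expectation_card_Collect:
      "measure_pmf.expectation p (\<lambda>x. real (card {i\<in>I. P i x}))
       = (\<Sum>i\<in>I. measure_pmf.prob p {x. P i x})"
proof -
  have "real (card {i\<in>I. P i x}) = (\<Sum>i\<in>I. indicator {x. P i x} x)" for x
    using assms by (simp add: indicator_def sum_of_bool_eq Int_def flip: of_bool_def)
  moreover have "integrable (measure_pmf p) (indicator {x. P i x} :: _ \<Rightarrow> real)" for i
    by (simp add: measure_pmf.emeasure_eq_measure)
  ultimately show "integrable (measure_pmf p) (\<lambda>x. real (card {i\<in>I. P i x}))"
    and "measure_pmf.expectation p (\<lambda>x. real (card {i\<in>I. P i x}))
       = (\<Sum>i\<in>I. measure_pmf.prob p {x. P i x})"
    by (simp_all add: integrable_sum integral_sum)
qed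

text \<open>By linearity, the expectations of the two fractions are the average success
  probabilities of the two families. Were all of these probabilities below \<delta>, the
  expectations would add up to less than \<open>2 * \<delta>\<close>.\<close>

lemma exists_prob_ge_average:
  assumes fin: "finite I" "finite J" and ne: "I \<noteq> {}" "J \<noteq> {}"
    and avg: "\<And>x. x \<in> set_pmf p \<Longrightarrow>
      2 * \<delta> \<le> real (card {i\<in>I. P i x}) / real (card I) + real (card {j\<in>J. R j x}) / real (card J)"
  shows "(\<exists>i\<in>I. \<delta> \<le> measure_pmf.prob p {x. P i x}) \<or> (\<exists>j\<in>J. \<delta> \<le> measure_pmf.prob p {x. R j x})"
proof (rule ccontr)
  assume "\<not> ?thesis"
  then have lt: "measure_pmf.prob p {x. P i x} < \<delta>" "measure_pmf.prob p {x. R j x} < \<delta>"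
    if "i \<in> I" "j \<in> J" for i j
    using that by (auto simp: not_le)
  have pos: "real (card I) > 0" "real (card J) > 0"
    using fin ne by (auto simp: card_gt_0_iff)
  have "2 * \<delta> = measure_pmf.expectation p (\<lambda>x. 2 * \<delta>)" by simp
  also have "\<dots> \<le> measure_pmf.expectation p (\<lambda>x. real (card {i\<in>I. P i x}) / real (card I)
      + real (card {j\<in>J. R j x}) / real (card J))"
    by (rule integral_mono_AE) (use avg fin in \<open>auto simp: AE_measure_pmf_iff integrable_card_Collect\<close>)
  also have "\<dots> = (\<Sum>i\<in>I. measure_pmf.prob p {x. P i x}) / real (card I)
      + (\<Sum>j\<in>J. measure_pmf.prob p {x. R j x}) / real (card J)"
    using fin by (simp add: integrable_card_Collect expectation_card_Collect)
  also have "\<dots> < (\<Sum>i\<in>I. \<delta>) / real (card I) + (\<Sum>j\<in>J. \<delta>) / real (card J)"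
    using fin ne pos lt by (intro add_strict_mono divide_strict_right_mono sum_strict_mono) auto
  also have "\<dots> = 2 * \<delta>" using pos by simp
  finally show False by simp
qed

section \<open>Strategies with a fixed list of queries\<close>

text \<open>Only the output pair depends on the answers, which are collected in \<sigma>.\<close>

primrec ask ::
  "'v list \<Rightarrow> (('v \<Rightarrow> 'l) \<Rightarrow> 'v \<times> 'v) \<Rightarrow> ('v \<Rightarrow> 'l) \<Rightarrow> ('v, 'l) strategy" where
  "ask [] g \<sigma> = Output (fst (g \<sigma>)) (snd (g \<sigma>))"
| "ask (x # xs) g \<sigma> = Query x (\<lambda>a. ask xs g (\<sigma>(x := a)))"

lemma forges_ask:
  "forges G dec lab (ask xs g \<sigma>) \<longleftrightarrow>
     (let (u, v) = g (override_on \<sigma> lab (set xs)) in (u, v) \<notin> parcs G \<and> dec (lab u) (lab v))"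
proof (induction xs arbitrary: \<sigma>)
  case (Cons x xs)
  have "override_on (\<sigma>(x := lab x)) lab (set xs) = override_on \<sigma> lab (set (x # xs))"
    by (auto simp: override_on_def)
  then show ?case by (simp only: ask.simps forges.simps Cons.IH)
qed (simp add: split_beta)

text \<open>\<open>legal\<close> ranges over all answers, so \<open>g\<close> is required to name an
  admissible pair for every \<sigma>. The earlier queries \<open>ys\<close> are carried along for
  the induction.\<close>

lemma legal_ask:
  assumes "length ys + length xs + 2 \<le> card V" "set xs \<subseteq> V"
    and "\<And>\<sigma> u v. g \<sigma> = (u, v) \<Longrightarrow> u \<in> V \<and> v \<in> V \<and> u \<noteq> v \<and> u \<notin> set ys \<union> set xs \<and> v \<notin> set ys \<union> set xs"
  shows "legal V L ys (ask xs g \<sigma>)"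
  using assms
proof (induction xs arbitrary: \<sigma> ys)
  case Nil
  show ?case using Nil(1) Nil(3)[of \<sigma> "fst (g \<sigma>)" "snd (g \<sigma>)"] by simp
next
  case (Cons x xs)
  have "legal V L (ys @ [x]) (ask xs g (\<sigma>(x := a)))" for a
    by (rule Cons.IH) (use Cons.prems in auto)
  then show ?case using Cons.prems by simp
qed

section \<open>The graph of disjoint edges\<close>

text \<open>The ends \<open>u\<^sub>i\<close> and \<open>v\<^sub>i\<close> of edge \<open>i\<close>
  are \<open>2 * i\<close> and \<open>2 * i + 1\<close>.\<close>

definition edges_graph :: "nat \<Rightarrow> nat pair_pre_digraph" where
  "edges_graph N = \<lparr>pverts = {..<2 * N},
     parcs = (\<lambda>i. (2 * i, 2 * i + 1)) ` {..<N} \<union> (\<lambda>i. (2 * i + 1, 2 * i)) ` {..<N}\<rparr>"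

lemma edge_sets_edges_graph: "edge_sets (edges_graph N) = (\<lambda>i. {2 * i, 2 * i + 1}) ` {..<N}"
  by (auto simp: edge_sets_def edges_graph_def image_def)

lemma edges_graph_in_matchings: "edges_graph N \<in> matchings"
proof -
  have "pair_graph (edges_graph N)"
    by unfold_locales (auto simp: edges_graph_def symmetric_def arcs_ends_def arc_to_ends_def sym_def)
  moreover have "\<Union> (edge_sets (edges_graph N)) = pverts (edges_graph N)"
  proof (intro equalityI subsetI)
    fix v assume "v \<in> pverts (edges_graph N)"
    then have "v div 2 < N" "v = 2 * (v div 2) \<or> v = 2 * (v div 2) + 1"
      by (auto simp: edges_graph_def)
    then show "v \<in> \<Union> (edge_sets (edges_graph N))"
      unfolding edge_sets_edges_graph by blast
  next
    fix v assume "v \<in> \<Union> (edge_sets (edges_graph N))"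
    then show "v \<in> pverts (edges_graph N)"
      unfolding edge_sets_edges_graph by (auto simp: edges_graph_def)
  qed
  moreover have "disjoint (edge_sets (edges_graph N))"
    by (auto simp: edge_sets_edges_graph disjoint_def) presburger+
  ultimately show ?thesis
    by (auto simp: matchings_def partition_on_def edge_sets_edges_graph)
qed

lemma parcs_edges_graph_iff:
  "(2 * i, Suc (2 * j)) \<in> parcs (edges_graph N) \<longleftrightarrow> i = j \<and> i < N"
  by (auto simp: edges_graph_def) presburger+

section \<open>The collision strategy\<close>

text \<open>
  The argument \<open>\<sigma>\<close> below is the labeling as known after the queries; it is the fixed junk value
  \<open>undefined\<close> outside of the queried vertices. \<open>J\<close> is the block of the edge \<open>e\<close>.
\<close>

definition candidates :: "nat \<Rightarrow> nat set \<Rightarrow> nat \<Rightarrow> (nat \<Rightarrow> 'l) \<Rightarrow> nat set" where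
  "candidates N J e \<sigma> =
     (let C = {i\<in>{..<N} - J. \<sigma> (2 * i) = \<sigma> (2 * e)} in if C = {} then {..<N} - J else C)"

text \<open>The implication under \<open>SOME\<close> makes any other edge of the block acceptable
  when none matches \<open>e\<close>. Together with the fallback in \<open>candidates\<close>, this
  yields a legal pair whatever the answers are.\<close>

definition collision_output :: "nat \<Rightarrow> nat set \<Rightarrow> nat \<Rightarrow> nat \<Rightarrow> (nat \<Rightarrow> 'l) \<Rightarrow> nat \<times> nat" where
  "collision_output N J e t \<sigma> =
     (2 * (SOME j. j \<in> J - {e} \<and>
        ((\<exists>k\<in>J - {e}. \<sigma> (2 * k + 1) = \<sigma> (2 * e + 1)) \<longrightarrow> \<sigma> (2 * j + 1) = \<sigma> (2 * e + 1))),
      2 * (sorted_list_of_set (candidates N J e \<sigma>) ! (t mod card (candidates N J e \<sigma>))) + 1)"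

text \<open>Apart from \<open>2 * e\<close>, only odd ends are queried inside the block and only
  even ends outside of it. This keeps \<open>2 * j\<close> and \<open>2 * i + 1\<close> fresh for
  \<open>j \<in> J - {e}\<close> and \<open>i\<close> outside of \<open>J\<close>.\<close>

definition collision_queries :: "nat \<Rightarrow> nat set \<Rightarrow> nat \<Rightarrow> nat list" where
  "collision_queries N J e =
     2 * e # map (\<lambda>j. 2 * j + 1) (sorted_list_of_set J) @ map ((*) 2) (sorted_list_of_set ({..<N} - J))"

definition collision_strategy ::
  "nat \<Rightarrow> nat set \<Rightarrow> nat \<Rightarrow> nat \<Rightarrow> (nat, 'l) strategy" where
  "collision_strategy N J e t =
     ask (collision_queries N J e) (collision_output N J e t) (\<lambda>_. undefined)"

lemma collision_output_cases:
  assumes J: "J \<subset> {..<N}" and J': "J - {e} \<noteq> {}"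
  obtains j i where "collision_output N J e t \<sigma> = (2 * j, 2 * i + 1)" "j \<in> J - {e}"
    "(\<exists>k\<in>J - {e}. \<sigma> (2 * k + 1) = \<sigma> (2 * e + 1)) \<longrightarrow> \<sigma> (2 * j + 1) = \<sigma> (2 * e + 1)"
    "i = sorted_list_of_set (candidates N J e \<sigma>) ! (t mod card (candidates N J e \<sigma>))"
    "i \<in> {..<N} - J"
proof -
  let ?P = "\<lambda>j. j \<in> J - {e} \<and>
    ((\<exists>k\<in>J - {e}. \<sigma> (2 * k + 1) = \<sigma> (2 * e + 1)) \<longrightarrow> \<sigma> (2 * j + 1) = \<sigma> (2 * e + 1))"
  let ?C = "candidates N J e \<sigma>"
  have j: "?P (SOME j. ?P j)"
    by (rule someI_ex) (use J' in blast)
  have C: "?C \<subseteq> {..<N} - J" "?C \<noteq> {}"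
    using J by (auto simp: candidates_def Let_def)
  have fC: "finite ?C" using C(1) by (rule finite_subset) simp
  then have "sorted_list_of_set ?C ! (t mod card ?C) \<in> set (sorted_list_of_set ?C)"
    using C(2) by (intro nth_mem) (simp add: card_gt_0_iff)
  then have "sorted_list_of_set ?C ! (t mod card ?C) \<in> {..<N} - J"
    using C(1) fC by auto
  then show thesis
    using that[OF _ _ _ refl] j unfolding collision_output_def by blast
qed

lemma legal_collision_strategy:
  assumes J: "J \<subset> {..<N}" and e: "e \<in> J" and J': "J - {e} \<noteq> {}"
  shows "legal {..<2 * N} L [] (collision_strategy N J e t)"
  unfolding collision_strategy_def
proof (rule legal_ask)
  have fJ: "finite J" using J finite_subset by blast
  then have J2: "2 \<le> card J"
    using e J' by (metis One_nat_def Suc_leI card_Suc_Diff1 card_gt_0_iff finite_Diff numeral_2_eq_2 Suc_le_mono)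
  have N: "card J < N" using J psubset_card_mono[of "{..<N}" J] by simp
  \<comment> \<open>There are \<open>N + 1\<close> queries, so the bound amounts to
    \<open>N \<ge> 3\<close>, which follows from \<open>2 \<le> card J < N\<close>.\<close>
  show "length [] + length (collision_queries N J e) + 2 \<le> card {..<2 * N}"
    using J J2 N fJ by (simp add: collision_queries_def card_Diff_subset psubset_imp_subset)
  show "set (collision_queries N J e) \<subseteq> {..<2 * N}"
    using J e fJ by (auto simp: collision_queries_def)
  fix \<sigma> :: "nat \<Rightarrow> 'b" and u v
  assume g: "collision_output N J e t \<sigma> = (u, v)"
  obtain j i where "(u, v) = (2 * j, 2 * i + 1)" "j \<in> J - {e}" "i \<in> {..<N} - J"
    using collision_output_cases[OF J J', of t \<sigma>] g by metis
  then show "u \<in> {..<2 * N} \<and> v \<in> {..<2 * N} \<and> u \<noteq> v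
      \<and> u \<notin> set [] \<union> set (collision_queries N J e) \<and> v \<notin> set [] \<union> set (collision_queries N J e)"
    using J fJ by (auto simp: collision_queries_def) presburger+
qed

text \<open>The output \<open>(2 * j, 2 * i + 1)\<close> has \<open>B j = B e\<close>. If also
  \<open>B i = B e\<close>, its labels are those of edge \<open>j\<close> and hence compatible,
  while \<open>i \<noteq> j\<close> because only \<open>j\<close> lies in the block. Excluding the
  block from the candidates loses at most \<open>card J\<close> good ones and can only shrink the
  denominator.\<close>

lemma card_forging_choices:
  fixes lab :: "nat \<Rightarrow> 'l" and dec :: "'l \<Rightarrow> 'l \<Rightarrow> bool"
  defines "A \<equiv> \<lambda>i. lab (2 * i)" and "B \<equiv> \<lambda>i. lab (2 * i + 1)"
  assumes J: "J \<subset> {..<N}" and e: "e \<in> J" and J': "\<exists>k\<in>J - {e}. B k = B e"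
    and dec: "\<And>i. i < N \<Longrightarrow> dec (A i) (B i)"
  shows "(real (card {i\<in>{..<N}. A i = A e \<and> B i = B e}) - real (card J))
            / real (card {i\<in>{..<N}. A i = A e})
         \<le> real (card {t\<in>{..<fact N}. forges (edges_graph N) dec lab (collision_strategy N J e t)})
            / fact N"
proof -
  define C where "C = {i\<in>{..<N} - J. A i = A e}"
  define W where "W = {c\<in>C. B c = B e}"
  define D where "D = {i\<in>{..<N}. A i = A e}"
  define D' where "D' = {i\<in>{..<N}. A i = A e \<and> B i = B e}"
  define T where "T = {t\<in>{..<fact N}. forges (edges_graph N) dec lab (collision_strategy N J e t)}"
  have fJ: "finite J" using J finite_subset by blast
  have fC: "finite C" "C \<subseteq> D" "finite D" by (auto simp: C_def D_def)
  have "card D' \<le> card (W \<union> J)"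
    by (rule card_mono) (auto simp: D'_def W_def C_def fJ)
  also have "\<dots> \<le> card W + card J" by (rule card_Un_le)
  finally have W: "real (card D') - real (card J) \<le> real (card W)" by simp
  have "(real (card D') - real (card J)) / real (card D) \<le> real (card W) / real (card D)"
    using W by (rule divide_right_mono) simp
  also have "\<dots> \<le> real (card T) / fact N"
  proof (cases "C = {}")
    case True
    then show ?thesis by (simp add: W_def)
  next
    case False
    \<comment> \<open>The knowledge of the strategy when it stops. It agrees with \<open>lab\<close>
      at every vertex whose label \<open>collision_output\<close> reads.\<close>
    define \<sigma> where "\<sigma> = override_on (\<lambda>_. undefined) lab (set (collision_queries N J e))"
    have \<sigma>A: "\<sigma> (2 * i) = A i" if "i \<in> insert e ({..<N} - J)" for i
      using that fJ by (auto simp: \<sigma>_def override_on_def collision_queries_def A_def)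
    have \<sigma>B: "\<sigma> (2 * i + 1) = B i" if "i \<in> J" for i
      using that fJ by (auto simp: \<sigma>_def override_on_def collision_queries_def B_def)
    have "{i\<in>{..<N} - J. \<sigma> (2 * i) = \<sigma> (2 * e)} = C"
      using \<sigma>A by (auto simp: C_def)
    then have cand: "candidates N J e \<sigma> = C"
      using False by (simp add: candidates_def)
    have "card C \<le> N" using card_mono[of "{..<N}" C] by (auto simp: C_def)
    moreover have "1 \<le> card C" using False fC by (simp add: Suc_le_eq card_gt_0_iff)
    ultimately have dvd: "card C dvd fact N" by (rule dvd_fact[rotated])
    have "{t\<in>{..<fact N}. B (sorted_list_of_set C ! (t mod card C)) = B e} \<subseteq> T"
    proof
      fix t assume t: "t \<in> {t\<in>{..<fact N}. B (sorted_list_of_set C ! (t mod card C)) = B e}"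
      obtain j i where out: "collision_output N J e t \<sigma> = (2 * j, 2 * i + 1)" "j \<in> J - {e}"
        "(\<exists>k\<in>J - {e}. \<sigma> (2 * k + 1) = \<sigma> (2 * e + 1)) \<longrightarrow> \<sigma> (2 * j + 1) = \<sigma> (2 * e + 1)"
        "i = sorted_list_of_set C ! (t mod card C)" "i \<in> {..<N} - J"
        using collision_output_cases[OF J, of e t \<sigma>] J' unfolding cand by (metis empty_iff)
      have "B j = B e" using out(2,3) J' \<sigma>B e by (metis DiffD1)
      then have "dec (A j) (B i)" using dec[of j] t out J by auto
      moreover have "j \<noteq> i" using out by auto
      ultimately show "t \<in> T"
        using t out(1) by (simp add: T_def collision_strategy_def forges_ask parcs_edges_graph_iff
            A_def B_def flip: \<sigma>_def)
    qed
    then have "real (card {t\<in>{..<fact N}. B (sorted_list_of_set C ! (t mod card C)) = B e}) \<le> real (card T)"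
      by (intro of_nat_mono card_mono) (auto simp: T_def)
    then have "fact N * (real (card W) / real (card C)) \<le> real (card T)"
      using card_nth_mod[OF fC(1) False dvd, of "\<lambda>c. B c = B e"] by (simp add: W_def)
    then have "real (card W) / real (card C) \<le> real (card T) / fact N"
      by (simp add: field_simps)
    moreover have "real (card W) / real (card D) \<le> real (card W) / real (card C)"
    proof (intro divide_left_mono)
      have "card C > 0" using fC False by (simp add: card_gt_0_iff)
      moreover have "card C \<le> card D" using fC by (simp add: card_mono)
      ultimately show "real (card C) \<le> real (card D)" "0 < real (card D) * real (card C)" by simp_all
    qed simp
    ultimately show ?thesis by simp
  qed
  finally show ?thesis by (simp add: D_def D'_def T_def)
qed

section \<open>Blocks and the cost of restricting to them\<close>

definition block :: "nat \<Rightarrow> nat \<Rightarrow> nat set" where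
  "block Q e = {e div Q * Q..<e div Q * Q + Q}"

lemma mem_block_iff:
  assumes "Q > 0"
  shows "j \<in> block Q e \<longleftrightarrow> j div Q = e div Q"
proof -
  have "j \<in> {c * Q..<c * Q + Q} \<longleftrightarrow> j div Q = c" for c
  proof
    assume "j \<in> {c * Q..<c * Q + Q}"
    then show "j div Q = c" by (intro div_nat_eqI) (simp_all add: mult.commute)
  next
    assume c: "j div Q = c"
    have "c * Q + j mod Q = j" unfolding c[symmetric] by (rule div_mult_mod_eq)
    moreover have "j mod Q < Q" using assms by simp
    ultimately show "j \<in> {c * Q..<c * Q + Q}"
      unfolding atLeastLessThan_iff by linarith
  qed
  then show ?thesis by (simp only: block_def)
qed

lemma card_block [simp]: "card (block Q e) = Q"
  by (simp add: block_def)

lemma block_psubset: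
  assumes "2 \<le> Q" "e < Q * Q"
  shows "block Q e \<subset> {..<Q * Q}"
proof -
  define c where "c = e div Q"
  have "c < Q" unfolding c_def using assms(2) by (rule less_mult_imp_div_less)
  then have "Suc c * Q \<le> Q * Q" by (intro mult_le_mono1) simp
  then have "block Q e \<subseteq> {..<Q * Q}"
    unfolding block_def c_def[symmetric] by auto
  moreover have "card (block Q e) \<noteq> card {..<Q * Q}" using assms(1) by simp
  then have "block Q e \<noteq> {..<Q * Q}" by metis
  ultimately show ?thesis by (rule psubsetI)
qed

text \<open>Unmatched edges of the same block have distinct labels \<open>B\<close>, so each of the
  \<open>Q\<close> blocks contains at most \<open>card L\<close> of them.\<close>

lemma card_unmatched_in_block:
  fixes B :: "nat \<Rightarrow> 'l"
  assumes Q: "Q > 0" and L: "finite L" "\<And>i. i < Q * Q \<Longrightarrow> B i \<in> L"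
  shows "card {e\<in>{..<Q * Q}. \<not> (\<exists>k\<in>block Q e - {e}. B k = B e)} \<le> Q * card L"
proof -
  let ?U = "{e\<in>{..<Q * Q}. \<not> (\<exists>k\<in>block Q e - {e}. B k = B e)}"
  have "card ?U = card (\<Union>c<Q. {e\<in>?U. e div Q = c})"
    by (rule arg_cong[where f = card]) (use less_mult_imp_div_less in blast)
  also have "\<dots> \<le> (\<Sum>c<Q. card {e\<in>?U. e div Q = c})"
    by (rule card_UN_le) simp
  also have "\<dots> \<le> (\<Sum>c<Q. card L)"
  proof (intro sum_mono card_inj_on_le[OF _ _ L(1)])
    fix c
    show "inj_on B {e\<in>?U. e div Q = c}"
      by (auto simp: inj_on_def mem_block_iff[OF Q])
  qed (use L in auto)
  finally show ?thesis by simp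
qed

text \<open>Two losses of at most \<open>Q * card L\<close> each: excluding the block costs
  \<open>Q / n e\<close> for each \<open>e\<close>, and the \<open>1 / n e\<close> add up to at most
  \<open>card L\<close>; edges unmatched in their block are given up entirely, at cost at most 1
  each.\<close>

lemma collision_forgeries:
  fixes lab :: "nat \<Rightarrow> 'l" and dec :: "'l \<Rightarrow> 'l \<Rightarrow> bool"
  defines "A \<equiv> \<lambda>i. lab (2 * i)" and "B \<equiv> \<lambda>i. lab (2 * i + 1)"
  assumes Q: "2 \<le> Q" and L: "finite L" "\<And>v. v < 2 * (Q * Q) \<Longrightarrow> lab v \<in> L"
    and dec: "\<And>i. i < Q * Q \<Longrightarrow> dec (A i) (B i)"
  shows "(\<Sum>e<Q * Q. real (card {i\<in>{..<Q * Q}. A i = A e \<and> B i = B e})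
              / real (card {i\<in>{..<Q * Q}. A i = A e})) - 2 * real Q * real (card L)
         \<le> real (card {p\<in>{..<Q * Q} \<times> {..<fact (Q * Q)}. forges (edges_graph (Q * Q)) dec lab
              (collision_strategy (Q * Q) (block Q (fst p)) (fst p) (snd p))}) / fact (Q * Q)"
proof -
  define N where "N = Q * Q"
  define w where "w e = real (card {i\<in>{..<N}. A i = A e \<and> B i = B e})" for e
  define n where "n e = real (card {i\<in>{..<N}. A i = A e})" for e
  define T where "T e = {t\<in>{..<fact N}. forges (edges_graph N) dec lab
    (collision_strategy N (block Q e) e t)}" for e
  define U where "U = {e\<in>{..<N}. \<not> (\<exists>k\<in>block Q e - {e}. B k = B e)}"
  have step: "w e / n e - real Q * (1 / n e) - of_bool (e \<in> U) \<le> real (card (T e)) / fact N"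
    if e: "e \<in> {..<N}" for e
  proof (cases "e \<in> U")
    case True
    have "w e \<le> n e" unfolding w_def n_def by (intro of_nat_mono card_mono) auto
    then have "w e / n e \<le> n e / n e" by (rule divide_right_mono) (simp add: n_def)
    also have "\<dots> \<le> 1" by simp
    finally have "w e / n e \<le> 1" .
    moreover have "0 \<le> real Q * (1 / n e)" "0 \<le> real (card (T e)) / fact N"
      by (simp_all add: n_def)
    moreover have "of_bool (e \<in> U) = (1 :: real)" using True by simp
    ultimately show ?thesis by linarith
  next
    case False
    have "(w e - real (card (block Q e))) / n e \<le> real (card (T e)) / fact N"
      unfolding w_def n_def T_def A_def B_def
    proof (rule card_forging_choices)
      show "block Q e \<subset> {..<N}" using block_psubset[OF Q] e by (simp add: N_def)
      show "e \<in> block Q e" using Q by (simp add: mem_block_iff)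
      show "\<exists>k\<in>block Q e - {e}. lab (2 * k + 1) = lab (2 * e + 1)"
        using False e by (auto simp: U_def B_def)
      show "dec (lab (2 * i)) (lab (2 * i + 1))" if "i < N" for i
        using dec[of i] that by (simp add: A_def B_def N_def)
    qed
    then show ?thesis using False by (simp add: diff_divide_distrib)
  qed
  have "(\<Sum>e<N. 1 / n e) \<le> real (card L)"
    unfolding n_def by (rule sum_inverse_card_fiber_le) (use L in \<open>auto simp: A_def N_def\<close>)
  then have "real Q * (\<Sum>e<N. 1 / n e) \<le> real Q * real (card L)"
    by (rule mult_left_mono) simp
  moreover have "real (card U) \<le> real Q * real (card L)"
    using card_unmatched_in_block[of Q L B] Q L
    by (simp add: U_def N_def B_def flip: of_nat_mult)
  ultimately have "(\<Sum>e<N. w e / n e) - 2 * real Q * real (card L)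
      \<le> (\<Sum>e<N. w e / n e) - real Q * (\<Sum>e<N. 1 / n e) - real (card U)"
    by simp
  also have "\<dots> = (\<Sum>e<N. w e / n e - real Q * (1 / n e) - of_bool (e \<in> U))"
  proof -
    have "(\<Sum>e<N. of_bool (e \<in> U)) = real (card U)"
      by (simp add: sum_of_bool_eq Int_def) (rule arg_cong[where f = card], auto simp: U_def)
    then show ?thesis by (simp only: sum_subtractf sum_distrib_left)
  qed
  also have "\<dots> \<le> (\<Sum>e<N. real (card (T e)) / fact N)"
    by (rule sum_mono) (rule step)
  also have "\<dots> = real (card (SIGMA e:{..<N}. T e)) / fact N"
    by (simp add: T_def flip: sum_divide_distrib)
  also have "(SIGMA e:{..<N}. T e) = {p\<in>{..<N} \<times> {..<fact N}. forges (edges_graph N) dec lab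
      (collision_strategy N (block Q (fst p)) (fst p) (snd p))}"
    by (auto simp: T_def)
  finally show ?thesis by (simp add: N_def w_def n_def)
qed

section \<open>The lower bound\<close>

text \<open>Diagonal pairs are edges of the graph and never count as forgeries, so they have to be
  discarded.\<close>

lemma card_off_diagonal_ge:
  assumes "finite X"
  shows "real (card {(i, j)\<in>X \<times> X. R i j}) - real (card X)
      \<le> real (card {p\<in>X \<times> X. fst p \<noteq> snd p \<and> R (fst p) (snd p)})"
proof -
  have "card {(i, j)\<in>X \<times> X. R i j}
      \<le> card ({p\<in>X \<times> X. fst p \<noteq> snd p \<and> R (fst p) (snd p)} \<union> (\<lambda>i. (i, i)) ` X)"
    using assms by (intro card_mono) auto
  also have "\<dots> \<le> card {p\<in>X \<times> X. fst p \<noteq> snd p \<and> R (fst p) (snd p)} + card ((\<lambda>i. (i, i)) ` X)"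
    by (rule card_Un_le)
  also have "card ((\<lambda>i. (i, i)) ` X) = card X"
    by (simp add: card_image inj_on_def)
  finally show ?thesis by linarith
qed

lemma labeling_scheme_edges_graph:
  fixes enc :: "nat pair_pre_digraph \<Rightarrow> (nat \<Rightarrow> 'l) pmf"
  assumes "labeling_scheme matchings L enc dec" "lab \<in> set_pmf (enc (edges_graph N))"
  shows "v < 2 * N \<Longrightarrow> lab v \<in> L" and "i < N \<Longrightarrow> dec (lab (2 * i)) (lab (2 * i + 1))"
  using assms edges_graph_in_matchings[of N]
  by (fastforce simp: labeling_scheme_def edges_graph_def)+

text \<open>For every labeling the success fractions of the two families add up to at least
  \<open>2 / sqrt m\<close> minus the losses. The losses are at most \<open>1 / sqrt m\<close>, so
  some member of one family succeeds with probability at least half of what remains.\<close>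

lemma forgery_lower_bound:
  fixes enc :: "nat pair_pre_digraph \<Rightarrow> (nat \<Rightarrow> 'l) pmf"
  assumes L: "finite L" "card L = m" and scheme: "labeling_scheme matchings L enc dec"
  shows "\<exists>G A. G \<in> matchings \<and> legal (pverts G) L [] A
    \<and> forgery_prob enc dec G A \<ge> 1 / 2 / sqrt (real m)"
proof -
  \<comment> \<open>Large enough for the losses:
    \<open>1 / N + 2 * m / Q \<le> 3 * m / Q = 3 / (4 * m)\<close>.\<close>
  define Q where "Q = 4 * m\<^sup>2"
  define N where "N = Q * Q"
  define X where "X = {..<N}"
  define G where "G = edges_graph N"
  define \<delta> where "\<delta> = 1 / 2 / sqrt (real m)"
  \<comment> \<open>A single edge already needs a label.\<close>
  have "m > 0"
  proof -
    obtain lab where "lab \<in> set_pmf (enc (edges_graph 1))"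
      using set_pmf_not_empty[of "enc (edges_graph 1)"] by blast
    then have "lab 0 \<in> L" by (rule labeling_scheme_edges_graph(1)[OF scheme]) simp
    then show ?thesis using L by (auto simp: card_gt_0_iff)
  qed
  then have m: "m \<ge> 1" "real m \<ge> 1" by simp_all
  then have "m\<^sup>2 \<ge> 1" by simp
  then have Q: "Q \<ge> 2" by (simp add: Q_def)
  then have N: "N \<ge> 2" unfolding N_def using le_square[of Q] by (rule le_trans)
  have \<delta>: "\<delta> > 0" using m by (simp add: \<delta>_def)
  have loss: "1 / real N + 2 * real m / real Q \<le> 1 / sqrt (real m)"
  proof -
    have sq: "sqrt (real m) \<le> real m" using m by (intro real_le_lsqrt) (auto simp: power2_eq_square)
    have "1 / real N \<le> 1 / real Q"
      using Q by (intro frac_le) (simp_all add: N_def)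
    also have "\<dots> \<le> real m / real Q" using m by (simp add: divide_right_mono)
    finally have "1 / real N + 2 * real m / real Q \<le> 3 * real m / real Q" by simp
    also have "\<dots> = 3 / 4 * (1 / real m)" using m by (simp add: Q_def power2_eq_square)
    also have "\<dots> \<le> 1 * (1 / real m)" using m by (intro mult_right_mono) auto
    also have "\<dots> \<le> 1 / sqrt (real m)" using m sq by (simp add: frac_le)
    finally show ?thesis .
  qed
  have avg: "2 * \<delta> \<le> real (card {p\<in>X \<times> X. forges G dec lab (Output (2 * fst p) (2 * snd p + 1))})
        / real (card (X \<times> X))
      + real (card {p\<in>X \<times> {..<fact N}. forges G dec lab
            (collision_strategy N (block Q (fst p)) (fst p) (snd p))})
        / real (card (X \<times> {..<fact N :: nat}))" (is "_ \<le> ?K1 / _ + ?K2 / _")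
    if lab: "lab \<in> set_pmf (enc G)" for lab
  proof -
    define A where "A i = lab (2 * i)" for i
    define B where "B i = lab (2 * i + 1)" for i
    note lab' = labeling_scheme_edges_graph[OF scheme lab[unfolded G_def]]
    have dec: "dec (A i) (B i)" if "i < N" for i
      using lab'(2)[OF that] by (simp add: A_def B_def)
    define S where "S = real (card {(i, j)\<in>X \<times> X. dec (A i) (B j)})"
    define T where "T = (\<Sum>e\<in>X. real (card {i\<in>X. A i = A e \<and> B i = B e})
      / real (card {i\<in>X. A i = A e}))"
    have "2 / sqrt (real (card L)) \<le> S / (real (card X))\<^sup>2 + T / real (card X)"
      unfolding S_def T_def
      by (rule compatible_collision_tradeoff)
        (use L N lab'(1) dec in \<open>auto simp: X_def B_def lessThan_empty_iff\<close>)
    then have main: "2 / sqrt (real m) \<le> S / (real N)\<^sup>2 + T / real N"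
      using L by (simp add: X_def)
    have "{p\<in>X \<times> X. forges G dec lab (Output (2 * fst p) (2 * snd p + 1))}
        = {p\<in>X \<times> X. fst p \<noteq> snd p \<and> dec (A (fst p)) (B (snd p))}"
      by (auto simp: G_def A_def B_def X_def parcs_edges_graph_iff)
    then have "S - real N \<le> ?K1"
      using card_off_diagonal_ge[of X "\<lambda>i j. dec (A i) (B j)"] by (simp add: S_def X_def)
    then have "(S - real N) / (real N)\<^sup>2 \<le> ?K1 / (real N)\<^sup>2"
      by (rule divide_right_mono) simp
    moreover have "real N / (real N)\<^sup>2 = 1 / real N"
      using N by (simp add: power2_eq_square)
    moreover have "real (card (X \<times> X)) = (real N)\<^sup>2"
      by (simp add: X_def card_cartesian_product power2_eq_square)
    ultimately have F1: "S / (real N)\<^sup>2 - 1 / real N \<le> ?K1 / real (card (X \<times> X))"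
      by (simp only: diff_divide_distrib)
    have "T - 2 * real Q * real m \<le> ?K2 / fact N"
      unfolding T_def A_def B_def X_def N_def G_def L(2)[symmetric]
      by (rule collision_forgeries[OF Q L(1)]) (fact lab'[unfolded N_def])+
    then have "(T - 2 * real Q * real m) / real N \<le> ?K2 / fact N / real N"
      by (rule divide_right_mono) simp
    moreover have "2 * real Q * real m / real N = 2 * real m / real Q"
      using Q by (simp add: N_def)
    moreover have "?K2 / fact N / real N = ?K2 / real (card (X \<times> {..<fact N :: nat}))"
      by (simp only: X_def card_cartesian_product card_lessThan of_nat_mult of_nat_fact
          divide_divide_eq_left mult.commute)
    ultimately have F2: "T / real N - 2 * real m / real Q
        \<le> ?K2 / real (card (X \<times> {..<fact N :: nat}))"
      by (simp only: diff_divide_distrib)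
    show ?thesis using main F1 F2 loss unfolding \<delta>_def by linarith
  qed
  have GM: "G \<in> matchings" by (simp add: G_def edges_graph_in_matchings)
  have V: "pverts G = {..<2 * N}" by (simp add: G_def edges_graph_def)
  have fin: "finite (X \<times> X)" "finite (X \<times> {..<fact N :: nat})"
    by (simp_all add: X_def)
  have ne: "X \<times> X \<noteq> {}" "X \<times> {..<fact N :: nat} \<noteq> {}"
    using N by (auto simp: X_def lessThan_empty_iff)
  have "(\<exists>p\<in>X \<times> X. \<delta> \<le> measure_pmf.prob (enc G)
        {lab. forges G dec lab (Output (2 * fst p) (2 * snd p + 1))})
    \<or> (\<exists>p\<in>X \<times> {..<fact N}. \<delta> \<le> measure_pmf.prob (enc G)
        {lab. forges G dec lab (collision_strategy N (block Q (fst p)) (fst p) (snd p))})"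
    by (rule exists_prob_ge_average[OF fin ne]) (rule avg)
  then consider p where "p \<in> X \<times> X"
      "\<delta> \<le> measure_pmf.prob (enc G) {lab. forges G dec lab (Output (2 * fst p) (2 * snd p + 1))}"
    | p where "p \<in> X \<times> {..<fact N :: nat}"
      "\<delta> \<le> measure_pmf.prob (enc G) {lab. forges G dec lab
          (collision_strategy N (block Q (fst p)) (fst p) (snd p))}"
    by blast
  then show ?thesis
  proof cases
    case 1
    \<comment> \<open>The first family includes the diagonal pairs, but these forge with probability
      \<open>0 < \<delta>\<close>.\<close>
    have "fst p \<noteq> snd p"
    proof
      assume "fst p = snd p"
      then have "{lab. forges G dec lab (Output (2 * fst p) (2 * snd p + 1))} = {}"
        using 1(1) by (auto simp: G_def X_def parcs_edges_graph_iff)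
      then show False using 1(2) \<delta> by (metis measure_empty not_less)
    qed
    then have "legal (pverts G) L [] (Output (2 * fst p) (2 * snd p + 1))"
      using 1(1) N unfolding V by (cases p) (auto simp: X_def)
    then show ?thesis using GM 1(2) unfolding forgery_prob_def \<delta>_def by blast
  next
    case 2
    have e: "fst p < N" using 2(1) by (auto simp: X_def)
    have "legal (pverts G) L [] (collision_strategy N (block Q (fst p)) (fst p) (snd p))"
      unfolding V
    proof (rule legal_collision_strategy)
      show "block Q (fst p) \<subset> {..<N}"
        using block_psubset[OF Q] e by (simp add: N_def)
      show "fst p \<in> block Q (fst p)" using Q by (simp add: mem_block_iff)
      then have "card (block Q (fst p) - {fst p}) = Q - 1" by simp
      then have "card (block Q (fst p) - {fst p}) \<noteq> 0" using Q by simp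
      then show "block Q (fst p) - {fst p} \<noteq> {}" by (metis card.empty)
    qed
    then show ?thesis using GM 2(2) unfolding forgery_prob_def \<delta>_def by blast
  qed
qed

theorem theorem2p3:
  shows "\<exists>c::real. c > 0 \<and>
    (\<forall>(m::nat) (L :: 'l set) (enc :: nat pair_pre_digraph \<Rightarrow> (nat \<Rightarrow> 'l) pmf)
        (dec :: 'l \<Rightarrow> 'l \<Rightarrow> bool).
      finite L \<longrightarrow> card L = m \<longrightarrow> labeling_scheme matchings L enc dec \<longrightarrow>
      (\<exists>(G :: nat pair_pre_digraph) (A :: (nat, 'l) strategy).
        G \<in> matchings \<and> legal (pverts G) L [] A \<and>
        forgery_prob enc dec G A \<ge> c / sqrt (real m)))"
  by (intro exI[of _ "1 / 2"] conjI allI impI) (simp, rule forgery_lower_bound)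

end
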